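(* Let $n\ge 1$, $c\in\{1,\dots,n\}$ and $r\ge n+1$ be integers. Let $H\subset\mathbb{P}^n$ be a hyperplane such that $H\cap\Delta_0=\emptyset$. Let $P_1,\dots,P_r\in\mathbb{P}^n\setminus\Delta_{n-1}$ and set $H_j=P_j\star H$ for all $j\in\{1,\dots,r\}$. Then $\mathbb{X}_c(H_1,\dots,H_r)$ is a weak Hadamard star configuration if and only if the points $\sigma(P_1),\dots,\sigma(P_r)$ are in general position in $\mathbb{P}^n$.
   Context: Work over $\mathbb{C}$; $\mathbb{P}^n$ is projective space with homogeneous coordinates $x_0,\dots,x_n$, $S=\mathbb{C}[x_0,\dots,x_n]$, and $S_1$ is the space of linear forms. $\Delta_i=\bigcup_{0\le j_1<\dots<j_{n-i}\le n}V(x_{j_1})\cap\dots\cap V(x_{j_{n-i}})$, i.e. the set of points with at most $i+1$ nonzero coordinates. So $\Delta_0$ is the set of coordinate points and $\Delta_{n-1}$ is the set of points with at least one zero coordinate. Hadamard product: for points $A=[a_0:\dots:a_n]$, $B=[b_0:\dots:b_n]$ with $a_ib_i\ne0$ for some $i$, $A\star B=[a_0b_0:\dots:a_nb_n]$ (otherwise it is not defined). For a point $P$ and a variety $X$, $P\star X$ is the closure of $\{P\star Q: Q\in X,\ P\star Q \text{ defined}\}$. If $P=[p_0:\dots:p_n]\notin\Delta_{n-1}$ and $H=V(\sum a_ix_i)$, then $P\star H=V(\sum (a_i/p_i)x_i)$. $\sigma:\mathbb{P}^n\dashrightarrow\mathbb{P}^n$ is the standard Cremona transformation $\sigma([p_0:\dots:p_n])=[1/p_0:\dots:1/p_n]$.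 Points $Q_1,\dots,Q_r$ ($r\ge n+1$) of $\mathbb{P}^n$ are in general position if no hyperplane contains $n+1$ of them (with distinct indices); equivalently, all maximal minors of the $r\times(n+1)$ matrix whose rows are the $Q_i$ are nonzero. A collection of linear forms $\mathcal{L}=\{L_1,\dots,L_r\}\subset S_1$ is generally linear if any $t\le n$ of them have common zero locus of dimension $n-t$ and any $t>n$ of them have empty common zero locus in $\mathbb{P}^n$. For generally linear $\mathcal{L}$ and $1\le c\le n$, the codimension $c$ star configuration defined by $\mathcal{L}$ is $\mathbb{X}_c(\mathcal{L})=\bigcup_{1\le i_1<\dots<i_c\le r}V(L_{i_1},\dots,L_{i_c})$. $\mathcal{L}$ is a Hadamard set if there are a linear form $L\in S_1$ and points $P_1,\dots,P_r\in\mathbb{P}^n$ with $V(L_i)=P_i\star V(L)$ for all $i$. A star configuration $\mathbb{X}_c(\mathcal{L})$ is a weak Hadamard star configuration (WHSC) if $\mathcal{L}$ is a Hadamard set. For hyperplanes $H_i=V(L_i)$, $\mathbb{X}_c(H_1,\dots,H_r)=\bigcup_{1\le i_1<\dots<i_c\le r}H_{i_1}\cap\dots\cap H_{i_c}$; it is called a WHSC when $\{L_1,\dots,L_r\}$ is generally linear (so that it is a star configuration) and is a Hadamard set. *)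

theory Defs
  imports "HOL-Analysis.Analysis" "HOL-Library.Poly_Mapping"
begin

text \<open>
  The homogeneous coordinates of \<open>\<P>\<^sup>n\<close> over the complex numbers are indexed by a finite type
  with \<open>n + 1\<close> elements, so that \<open>n = CARD('n) - 1\<close> throughout.
\<close>

section \<open>Projective space\<close>

definition proportional :: "complex ^ 'n \<Rightarrow> complex ^ 'n \<Rightarrow> bool" where
  "proportional v w \<longleftrightarrow> v \<noteq> 0 \<and> w \<noteq> 0 \<and> (\<exists>k. k \<noteq> 0 \<and> w = k *s v)"

lemma part_equivp_proportional: "part_equivp proportional"
proof (rule part_equivpI)
  show "\<exists>x. proportional x x"
    by (rule exI[of _ "1"]) (auto simp: proportional_def intro: exI[of _ 1])
  show "symp proportional"
  proof (rule sympI)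
    fix v w :: "complex ^ 'n"
    assume "proportional v w"
    then obtain k where "v \<noteq> 0" "w \<noteq> 0" "k \<noteq> 0" "w = k *s v"
      by (auto simp: proportional_def)
    then show "proportional w v"
      unfolding proportional_def by (auto intro!: exI[of _ "inverse k"])
  qed
  show "transp proportional"
  proof (rule transpI)
    fix u v w :: "complex ^ 'n"
    assume "proportional u v" "proportional v w"
    then obtain k l where "u \<noteq> 0" "w \<noteq> 0" "k \<noteq> 0" "l \<noteq> 0" "v = k *s u" "w = l *s v"
      by (auto simp: proportional_def)
    then show "proportional u w"
      unfolding proportional_def by (auto intro!: exI[of _ "l * k"])
  qed
qed

quotient_type (overloaded) 'n proj = "complex ^ ('n::finite)" / partial: proportional
  morphisms coords of_coords
  by (rule part_equivp_proportional)

lemma coords_nonzero: "coords P \<noteq> 0"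
  using Quotient_rep_reflp[OF Quotient_proj, of P] by (auto simp: proportional_def)

lemma of_coords_coords [simp]: "of_coords (coords P) = P"
  using Quotient_abs_rep[OF Quotient_proj] .

lemma of_coords_eq_iff:
  assumes "v \<noteq> 0" "w \<noteq> 0"
  shows "of_coords v = of_coords w \<longleftrightarrow> (\<exists>k. k \<noteq> 0 \<and> w = k *s v)"
proof -
  have "proportional v v" "proportional w w"
    using assms by (auto simp: proportional_def intro: exI[of _ 1])
  then have "of_coords v = of_coords w \<longleftrightarrow> proportional v w"
    using Quotient_rel[OF Quotient_proj, of v w] by blast
  then show ?thesis
    using assms by (auto simp: proportional_def)
qed

lemma coords_of_coords:
  assumes "v \<noteq> 0"
  obtains k where "k \<noteq> 0" "coords (of_coords v) = k *s v"
  using of_coords_eq_iff[OF assms coords_nonzero[of "of_coords v"]] by auto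

section \<open>Forms and projective varieties\<close>

type_synonym 'n polynomial = "('n \<Rightarrow>\<^sub>0 nat) \<Rightarrow>\<^sub>0 complex"

definition homogeneous :: "nat \<Rightarrow> ('n::finite) polynomial \<Rightarrow> bool" where
  "homogeneous d f \<longleftrightarrow> (\<forall>m \<in> Poly_Mapping.keys f. (\<Sum>i\<in>UNIV. Poly_Mapping.lookup m i) = d)"

abbreviation linear_form :: "('n::finite) polynomial \<Rightarrow> bool" where
  "linear_form \<equiv> homogeneous 1"

definition variable :: "'n \<Rightarrow> ('n::finite) polynomial" where
  "variable j = Poly_Mapping.single (Poly_Mapping.single j 1) 1"

definition eval_poly :: "('n::finite) polynomial \<Rightarrow> complex ^ 'n \<Rightarrow> complex" where
  "eval_poly f v = (\<Sum>m\<in>Poly_Mapping.keys f.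
     Poly_Mapping.lookup f m * (\<Prod>i\<in>UNIV. (v $ i) ^ Poly_Mapping.lookup m i))"

text \<open>
  The set \<open>V(F)\<close>. It is only used for sets of homogeneous polynomials, where the choice of
  the representative \<open>coords P\<close> is irrelevant.
\<close>

definition zero_locus :: "('n::finite) polynomial set \<Rightarrow> 'n proj set" where
  "zero_locus F = {P. \<forall>f\<in>F. eval_poly f (coords P) = 0}"

lemma eval_poly_scale:
  assumes "homogeneous d f"
  shows "eval_poly f (k *s v) = k ^ d * eval_poly f v"
  using assms unfolding eval_poly_def homogeneous_def sum_distrib_left
  by (intro sum.cong) (auto simp: power_mult_distrib prod.distrib power_sum[symmetric])

lemma of_coords_in_zero_locus_iff:
  assumes "v \<noteq> 0" "\<And>f. f \<in> F \<Longrightarrow> \<exists>d. homogeneous d f"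
  shows "of_coords v \<in> zero_locus F \<longleftrightarrow> (\<forall>f\<in>F. eval_poly f v = 0)"
proof -
  obtain k where "k \<noteq> 0" "coords (of_coords v) = k *s v"
    using coords_of_coords[OF assms(1)] .
  moreover have "eval_poly f (k *s v) = 0 \<longleftrightarrow> eval_poly f v = 0" if "f \<in> F" for f
    using assms(2)[OF that] \<open>k \<noteq> 0\<close> by (auto simp: eval_poly_scale)
  ultimately show ?thesis
    by (simp add: zero_locus_def)
qed

lemma eval_variable: "eval_poly (variable j) v = v $ j"
proof -
  have "(\<Prod>i\<in>UNIV. v $ i ^ Poly_Mapping.lookup (Poly_Mapping.single j (1::nat)) i)
      = (\<Prod>i\<in>UNIV. if i = j then v $ j else 1)"
    by (intro prod.cong) (auto simp: lookup_single when_def)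
  then show ?thesis
    by (simp add: eval_poly_def variable_def)
qed

definition zariski_closed :: "('n::finite) proj set \<Rightarrow> bool" where
  "zariski_closed X \<longleftrightarrow> (\<exists>F. (\<forall>f\<in>F. \<exists>d. homogeneous d f) \<and> X = zero_locus F)"

definition hyperplane :: "('n::finite) proj set \<Rightarrow> bool" where
  "hyperplane H \<longleftrightarrow> (\<exists>L. linear_form L \<and> L \<noteq> 0 \<and> H = zero_locus {L})"

text \<open>
  \<open>X\<close> is a linear subvariety of projective dimension \<open>d\<close>, i.e. the projectivisation of a
  linear subspace of dimension \<open>d + 1\<close>. Common zero loci of linear forms are always
  projectivisations of linear subspaces, so no other notion of dimension is needed for them.
\<close>

definition linear_subvariety_of_dim :: "nat \<Rightarrow> ('n::finite) proj set \<Rightarrow> bool" where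
  "linear_subvariety_of_dim d X \<longleftrightarrow>
     (\<exists>W. vec.subspace W \<and> vec.dim W = d + 1 \<and> X = of_coords ` (W - {0}))"

text \<open>The parameter \<open>i\<close> is meant to satisfy \<open>i \<le> n\<close>.\<close>

definition coord_locus :: "nat \<Rightarrow> ('n::finite) proj set" where
  "coord_locus i = (\<Union>J\<in>{J. card J = CARD('n) - 1 - i}. \<Inter>j\<in>J. zero_locus {variable j})"

section \<open>Hadamard products and the Cremona transformation\<close>

text \<open>Multiplication on the vector type is componentwise.\<close>

definition hadamard_defined :: "('n::finite) proj \<Rightarrow> 'n proj \<Rightarrow> bool" where
  "hadamard_defined A B \<longleftrightarrow> (\<exists>i. coords A $ i * coords B $ i \<noteq> 0)"

definition hadamard :: "('n::finite) proj \<Rightarrow> 'n proj \<Rightarrow> 'n proj" where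
  "hadamard A B = of_coords (coords A * coords B)"

definition hadamard_variety :: "('n::finite) proj \<Rightarrow> 'n proj set \<Rightarrow> 'n proj set" (infixr \<open>\<star>\<close> 75)
  where "P \<star> X = zariski_closed hull {hadamard P Q | Q. Q \<in> X \<and> hadamard_defined P Q}"

text \<open>Only meaningful at points without zero coordinates (recall \<open>inverse 0 = 0\<close>).\<close>

definition cremona :: "('n::finite) proj \<Rightarrow> 'n proj" where
  "cremona P = of_coords (\<chi> i. 1 / coords P $ i)"

lemma hadamard_defined_of_coords:
  assumes "a \<noteq> 0" "b \<noteq> 0"
  shows "hadamard_defined (of_coords a) (of_coords b) \<longleftrightarrow> a * b \<noteq> 0"
proof -
  obtain k l where "k \<noteq> 0" "coords (of_coords a) = k *s a" "l \<noteq> 0" "coords (of_coords b) = l *s b"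
    using coords_of_coords assms by metis
  then show ?thesis
    by (auto simp: hadamard_defined_def vec_eq_iff)
qed

lemma hadamard_of_coords:
  assumes "a * b \<noteq> 0"
  shows "hadamard (of_coords a) (of_coords b) = of_coords (a * b)"
proof -
  have "a \<noteq> 0" "b \<noteq> 0"
    using assms by auto
  then obtain k l where kl: "k \<noteq> 0" "coords (of_coords a) = k *s a"
      "l \<noteq> 0" "coords (of_coords b) = l *s b"
    using coords_of_coords by metis
  have eq: "k *s a * (l *s b) = (k * l) *s (a * b)"
    by (simp add: vec_eq_iff)
  moreover have "(k * l) *s (a * b) \<noteq> 0"
    using kl assms by simp
  ultimately show ?thesis
    using of_coords_eq_iff[OF assms, of "(k * l) *s (a * b)"] kl by (auto simp: hadamard_def)
qed

lemma cremona_of_coords: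
  assumes "\<And>i. v $ i \<noteq> 0"
  shows "cremona (of_coords v) = of_coords (\<chi> i. 1 / v $ i)"
proof -
  have "v \<noteq> 0"
    using assms by (metis zero_index)
  then obtain k where k: "k \<noteq> 0" "coords (of_coords v) = k *s v"
    using coords_of_coords by metis
  define w where "w = (\<chi> i. 1 / v $ i)"
  have "w \<noteq> 0"
    using assms by (auto simp: w_def vec_eq_iff)
  moreover have "(\<chi> i. 1 / (k *s v) $ i) = inverse k *s w"
    using assms by (simp add: w_def vec_eq_iff field_simps)
  moreover have "inverse k *s w \<noteq> 0"
    using k \<open>w \<noteq> 0\<close> by simp
  ultimately have "of_coords w = of_coords (\<chi> i. 1 / (k *s v) $ i)"
    using of_coords_eq_iff[of w "inverse k *s w"] k(1) by (metis inverse_nonzero_iff_nonzero)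
  then show ?thesis
    by (simp add: cremona_def k w_def)
qed

section \<open>General position and star configurations\<close>

text \<open>
  Collections \<open>Q\<^sub>1, \<dots>, Q\<^sub>r\<close> are families indexed by \<open>{1..r}\<close>; repetitions are allowed
  and ``any \<open>t\<close> of them'' refers to \<open>t\<close> distinct indices.
\<close>

definition general_position :: "nat \<Rightarrow> (nat \<Rightarrow> ('n::finite) proj) \<Rightarrow> bool" where
  "general_position r Q \<longleftrightarrow>
     (\<forall>I. I \<subseteq> {1..r} \<and> card I = CARD('n) \<longrightarrow> \<not> (\<exists>H. hyperplane H \<and> Q ` I \<subseteq> H))"

definition generally_linear :: "nat \<Rightarrow> (nat \<Rightarrow> ('n::finite) polynomial) \<Rightarrow> bool" where
  "generally_linear r L \<longleftrightarrow> (\<forall>i\<in>{1..r}. linear_form (L i)) \<and>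
     (\<forall>I. I \<subseteq> {1..r} \<longrightarrow>
        (card I \<le> CARD('n) - 1 \<longrightarrow>
           linear_subvariety_of_dim (CARD('n) - 1 - card I) (zero_locus (L ` I))) \<and>
        (card I > CARD('n) - 1 \<longrightarrow> zero_locus (L ` I) = {}))"

definition hadamard_set :: "nat \<Rightarrow> (nat \<Rightarrow> ('n::finite) polynomial) \<Rightarrow> bool" where
  "hadamard_set r L \<longleftrightarrow> (\<forall>i\<in>{1..r}. linear_form (L i)) \<and>
     (\<exists>M P. linear_form M \<and> (\<forall>i\<in>{1..r}. zero_locus {L i} = P i \<star> zero_locus {M}))"

definition star_union :: "nat \<Rightarrow> nat \<Rightarrow> (nat \<Rightarrow> ('n::finite) proj set) \<Rightarrow> 'n proj set" where
  "star_union c r H = (\<Union>I\<in>{I. I \<subseteq> {1..r} \<and> card I = c}. \<Inter>i\<in>I. H i)"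

definition star_configuration ::
    "nat \<Rightarrow> nat \<Rightarrow> (nat \<Rightarrow> ('n::finite) polynomial) \<Rightarrow> 'n proj set \<Rightarrow> bool" where
  "star_configuration c r L X \<longleftrightarrow> generally_linear r L \<and> 1 \<le> c \<and> c \<le> CARD('n) - 1 \<and>
     X = (\<Union>I\<in>{I. I \<subseteq> {1..r} \<and> card I = c}. zero_locus (L ` I))"

text \<open>
  Being a weak Hadamard star configuration is a property of \<open>X = \<X>\<^sub>c(H\<^sub>1, \<dots>, H\<^sub>r)\<close> together
  with the hyperplanes \<open>H\<^sub>i = V(L\<^sub>i)\<close> defining it, not of the bare point set. The forms \<open>L\<^sub>i\<close>
  are determined by the hyperplanes up to nonzero scalars.
\<close>

definition weak_hadamard_star_configuration ::
    "nat \<Rightarrow> nat \<Rightarrow> (nat \<Rightarrow> ('n::finite) proj set) \<Rightarrow> 'n proj set \<Rightarrow> bool" where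
  "weak_hadamard_star_configuration c r H X \<longleftrightarrow>
     (\<exists>L. (\<forall>i\<in>{1..r}. H i = zero_locus {L i}) \<and> star_configuration c r L X \<and> hadamard_set r L)"

end

theory Submission
  imports Defs
begin

text \<open>
  Write \<open>H = V(\<Sum> a\<^sub>i x\<^sub>i)\<close> and \<open>P\<^sub>j = [p\<^sub>j\<^sub>0 : \<dots> : p\<^sub>j\<^sub>n]\<close>. Missing the coordinate points means that
  every \<open>a\<^sub>i\<close> is nonzero, and lying off the coordinate hyperplanes means that every \<open>p\<^sub>j\<^sub>i\<close> is nonzero.
  Hence \<open>P\<^sub>j \<star> H\<close> is the hyperplane with coefficient vector \<open>(a\<^sub>i / p\<^sub>j\<^sub>i)\<^sub>i\<close>
  (\<open>hadamard_hyperplane\<close>), which is the coordinate vector of \<open>\<sigma>(P\<^sub>j)\<close> multiplied by the invertible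
  diagonal matrix with entries \<open>a\<^sub>i\<close>.

  Both sides of the equivalence say that some family of vectors has the property that any \<open>n + 1\<close>
  of its members are linearly independent. The property is expressed here in its dual form: any
  \<open>n + 1\<close> members have no common nonzero annihilator with respect to the pairing
  \<open>\<Sum> b\<^sub>i v\<^sub>i\<close>. For general position of \<open>\<sigma>(P\<^sub>1), \<dots>, \<sigma>(P\<^sub>r)\<close>, such an annihilator is
  the coefficient vector of a hyperplane through \<open>n + 1\<close> of the points
  (\<open>general_position_iff_full_rank\<close>); for general linearity of the forms defining \<open>P\<^sub>j \<star> H\<close>, it is
  a common zero of \<open>n + 1\<close> of the forms (\<open>generally_linear_iff_full_rank\<close>). The latter equivalence
  needs the dimension formula for fewer than \<open>n + 1\<close> forms as well; since \<open>r \<ge> n + 1\<close>, any such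
  subfamily extends to \<open>n + 1\<close> forms, which constitute a system of coordinates. As multiplication by a
  diagonal matrix with nonzero entries respects the property (\<open>full_rank_mult\<close>), both sides agree.
  The family of the \<open>P\<^sub>j \<star> H\<close> is a Hadamard set by construction.
\<close>

section \<open>Linear forms and their coefficient vectors\<close>

definition pairing :: "complex ^ 'n \<Rightarrow> complex ^ 'n \<Rightarrow> complex" where
  "pairing b v = (\<Sum>i\<in>UNIV. b $ i * v $ i)"

lemma pairing_commute: "pairing b v = pairing v b"
  by (simp add: pairing_def mult.commute)

lemma pairing_scale_left [simp]: "pairing (k *s b) v = k * pairing b v"
  by (simp add: pairing_def sum_distrib_left mult.assoc)

lemma pairing_axis [simp]: "pairing b (axis k 1) = b $ k"
proof -
  have "pairing b (axis k 1) = (\<Sum>i\<in>UNIV. if i = k then b $ k else 0)"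
    unfolding pairing_def by (intro sum.cong) (auto simp: axis_def)
  then show ?thesis
    by simp
qed

lemma pairing_mult_left: "pairing (a * b) v = pairing b (a * v)"
  by (simp add: pairing_def mult_ac)

lemma subspace_common_kernel: "vec.subspace {v. \<forall>i\<in>I. pairing (b i) v = 0}"
  unfolding vec.subspace_def
  by (auto simp: pairing_def distrib_left sum.distrib sum_distrib_left[symmetric] mult.left_commute)

definition lin_form :: "complex ^ 'n \<Rightarrow> ('n::finite) polynomial" where
  "lin_form b = (\<Sum>i\<in>UNIV. Poly_Mapping.single (Poly_Mapping.single i 1) (b $ i))"

definition lin_coeffs :: "('n::finite) polynomial \<Rightarrow> complex ^ 'n" where
  "lin_coeffs L = (\<chi> i. Poly_Mapping.lookup L (Poly_Mapping.single i 1))"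

lemma inj_single_1: "inj (\<lambda>i. Poly_Mapping.single i (1::nat))"
  by (intro injI) (metis lookup_single_eq lookup_single_not_eq one_neq_zero)

lemma degree_1_exponent:
  fixes m :: "('n::finite) \<Rightarrow>\<^sub>0 nat"
  assumes "(\<Sum>i\<in>UNIV. Poly_Mapping.lookup m i) = 1"
  obtains i where "m = Poly_Mapping.single i 1"
proof -
  obtain i where "Poly_Mapping.lookup m i = 1" "\<forall>j. j \<noteq> i \<longrightarrow> Poly_Mapping.lookup m j = 0"
    using assms by (auto simp: sum_eq_1_iff simp del: One_nat_def)
  then have "m = Poly_Mapping.single i 1"
    by (intro poly_mapping_eqI) (auto simp: lookup_single when_def)
  then show ?thesis
    by (rule that)
qed

lemma keys_linear_form:
  assumes "linear_form L"
  shows "Poly_Mapping.keys L \<subseteq> range (\<lambda>i. Poly_Mapping.single i 1)"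
proof
  fix m assume "m \<in> Poly_Mapping.keys L"
  then have "(\<Sum>i\<in>UNIV. Poly_Mapping.lookup m i) = 1"
    using assms by (auto simp: homogeneous_def)
  then show "m \<in> range (\<lambda>i. Poly_Mapping.single i 1)"
    by (rule degree_1_exponent) auto
qed

lemma lookup_lin_form:
  "Poly_Mapping.lookup (lin_form b) m =
     (\<Sum>i\<in>UNIV. if Poly_Mapping.single i 1 = m then b $ i else 0)"
  by (simp add: lin_form_def lookup_sum lookup_single when_def)

lemma lin_coeffs_lin_form [simp]: "lin_coeffs (lin_form b) = b"
  by (simp add: lin_coeffs_def lookup_lin_form vec_eq_iff inj_eq[OF inj_single_1] del: One_nat_def)

lemma linear_form_lin_form: "linear_form (lin_form b)"
  unfolding homogeneous_def
proof
  fix m assume "m \<in> Poly_Mapping.keys (lin_form b)"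
  then have "\<exists>i. Poly_Mapping.single i 1 = m"
    by (auto simp: in_keys_iff lookup_lin_form dest: sum.not_neutral_contains_not_neutral
        split: if_splits)
  then show "(\<Sum>i\<in>UNIV. Poly_Mapping.lookup m i) = 1"
    by (auto simp: lookup_single when_def)
qed

lemma lin_form_lin_coeffs:
  assumes "linear_form L"
  shows "lin_form (lin_coeffs L) = L"
proof (rule poly_mapping_eqI)
  fix m
  show "Poly_Mapping.lookup (lin_form (lin_coeffs L)) m = Poly_Mapping.lookup L m"
  proof (cases "m \<in> range (\<lambda>i. Poly_Mapping.single i 1)")
    case True
    then obtain i where m: "m = Poly_Mapping.single i 1"
      by auto
    have "lin_coeffs (lin_form (lin_coeffs L)) $ i = lin_coeffs L $ i"
      by simp
    then show ?thesis
      by (simp add: lin_coeffs_def m)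
  next
    case False
    then have "m \<notin> Poly_Mapping.keys L" "m \<notin> Poly_Mapping.keys (lin_form (lin_coeffs L))"
      using keys_linear_form[OF assms] keys_linear_form[OF linear_form_lin_form] by blast+
    then show ?thesis
      by (simp add: in_keys_iff)
  qed
qed

lemma eval_lin_form [simp]: "eval_poly (lin_form b) v = pairing b v"
proof -
  let ?L = "lin_form b"
  have "eval_poly ?L v = (\<Sum>m\<in>range (\<lambda>i. Poly_Mapping.single i 1).
      Poly_Mapping.lookup ?L m * (\<Prod>i\<in>UNIV. (v $ i) ^ Poly_Mapping.lookup m i))"
    unfolding eval_poly_def
    by (intro sum.mono_neutral_left keys_linear_form linear_form_lin_form) (auto simp: in_keys_iff)
  also have "\<dots> = (\<Sum>j\<in>UNIV. b $ j *
      (\<Prod>i\<in>UNIV. (v $ i) ^ Poly_Mapping.lookup (Poly_Mapping.single j 1) i))"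
  proof -
    have "Poly_Mapping.lookup ?L (Poly_Mapping.single j 1) = b $ j" for j
      using lin_coeffs_lin_form[of b] unfolding lin_coeffs_def by (metis vec_lambda_beta)
    then show ?thesis
      by (simp add: sum.reindex[OF inj_single_1] del: One_nat_def)
  qed
  also have "\<dots> = pairing b v"
    unfolding pairing_def
  proof (intro sum.cong refl arg_cong2[where f = "(*)"])
    fix j
    have "(\<Prod>i\<in>UNIV. v $ i ^ Poly_Mapping.lookup (Poly_Mapping.single j (1::nat)) i)
        = (\<Prod>i\<in>UNIV. if i = j then v $ j else 1)"
      by (intro prod.cong) (auto simp: lookup_single when_def)
    then show "(\<Prod>i\<in>UNIV. v $ i ^ Poly_Mapping.lookup (Poly_Mapping.single j (1::nat)) i) = v $ j"
      by simp
  qed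
  finally show ?thesis .
qed

lemma in_hyperplane_iff [simp]:
  "P \<in> zero_locus {lin_form b} \<longleftrightarrow> pairing b (coords P) = 0"
  by (simp add: zero_locus_def)

lemma of_coords_in_hyperplane_iff:
  assumes "v \<noteq> 0"
  shows "of_coords v \<in> zero_locus {lin_form b} \<longleftrightarrow> pairing b v = 0"
  using of_coords_in_zero_locus_iff[OF assms, of "{lin_form b}"] linear_form_lin_form
  by (metis eval_lin_form singletonD singletonI)

lemma hyperplane_iff: "hyperplane H \<longleftrightarrow> (\<exists>b. b \<noteq> 0 \<and> H = zero_locus {lin_form b})"
proof -
  have "lin_form b = 0 \<longleftrightarrow> b = 0" for b :: "complex ^ 'n"
  proof -
    have "lin_form (0 :: complex ^ 'n) = 0"
      by (simp add: lin_form_def)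
    then show ?thesis
      by (metis lin_coeffs_lin_form)
  qed
  then show ?thesis
    unfolding hyperplane_def by (metis lin_form_lin_coeffs linear_form_lin_form)
qed

lemma zero_locus_image: "zero_locus (L ` I) = (\<Inter>i\<in>I. zero_locus {L i})"
  by (auto simp: zero_locus_def)

lemma zero_locus_lin_forms:
  "zero_locus ((\<lambda>i. lin_form (b i)) ` I) =
     of_coords ` ({v. \<forall>i\<in>I. pairing (b i) v = 0} - {0})"
proof (intro equalityI subsetI)
  fix R assume "R \<in> zero_locus ((\<lambda>i. lin_form (b i)) ` I)"
  then have "coords R \<in> {v. \<forall>i\<in>I. pairing (b i) v = 0} - {0}"
    by (simp add: zero_locus_image coords_nonzero)
  then show "R \<in> of_coords ` ({v. \<forall>i\<in>I. pairing (b i) v = 0} - {0})"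
    by (intro image_eqI[where x = "coords R"]) simp_all
next
  fix R assume "R \<in> of_coords ` ({v. \<forall>i\<in>I. pairing (b i) v = 0} - {0})"
  then show "R \<in> zero_locus ((\<lambda>i. lin_form (b i)) ` I)"
    unfolding zero_locus_image by (auto simp: of_coords_in_hyperplane_iff simp del: in_hyperplane_iff)
qed

section \<open>Families of vectors of full rank\<close>

text \<open>
  Nonvanishing of all maximal minors of the matrix with rows \<open>b\<^sub>1, \<dots>, b\<^sub>r\<close>, phrased through
  annihilators because hyperplanes through points and common zeros of forms both appear as such.
\<close>

definition full_rank :: "nat \<Rightarrow> (nat \<Rightarrow> complex ^ ('n::finite)) \<Rightarrow> bool" where
  "full_rank r b \<longleftrightarrow> (\<forall>I v. I \<subseteq> {1..r} \<and> card I = CARD('n) \<and> (\<forall>i\<in>I. pairing (b i) v = 0) \<longrightarrow> v = 0)"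

text \<open>
  A common annihilator of the vectors \<open>a * b\<^sub>j\<close> becomes one of the vectors \<open>b\<^sub>j\<close> after multiplying
  it by \<open>a\<close>, and this correspondence is bijective.
\<close>

lemma full_rank_mult:
  fixes a :: "complex ^ ('n::finite)"
  assumes a: "\<And>i. a $ i \<noteq> 0"
  shows "full_rank r (\<lambda>j. a * b j) \<longleftrightarrow> full_rank r b"
proof
  assume *: "full_rank r (\<lambda>j. a * b j)"
  show "full_rank r b"
    unfolding full_rank_def
  proof (intro allI impI, elim conjE)
    fix I v assume I: "I \<subseteq> {1..r}" "card I = CARD('n)" and v: "\<forall>i\<in>I. pairing (b i) v = 0"
    define w where "w = (\<chi> i. v $ i / a $ i)"
    have vw: "v = a * w"
      using a by (simp add: w_def vec_eq_iff)
    then have "w = 0"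
      using * I v by (auto simp: full_rank_def pairing_mult_left)
    then show "v = 0"
      by (simp add: vw)
  qed
next
  assume *: "full_rank r b"
  show "full_rank r (\<lambda>j. a * b j)"
    unfolding full_rank_def
  proof (intro allI impI, elim conjE)
    fix I v assume "I \<subseteq> {1..r}" "card I = CARD('n)" "\<forall>i\<in>I. pairing (a * b i) v = 0"
    then have "a * v = 0"
      using * by (auto simp: full_rank_def pairing_mult_left)
    then show "v = 0"
      using a by (simp add: vec_eq_iff)
  qed
qed

lemma full_rank_scale:
  assumes "\<And>j. j \<in> {1..r} \<Longrightarrow> k j \<noteq> 0 \<and> b' j = k j *s b j"
  shows "full_rank r b' \<longleftrightarrow> full_rank r b"
proof -
  have "pairing (b' i) v = 0 \<longleftrightarrow> pairing (b i) v = 0" if "I \<subseteq> {1..r}" "i \<in> I" for I i v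
    using assms that by auto
  then show ?thesis
    unfolding full_rank_def by blast
qed

text \<open>
  The functionals \<open>b\<^sub>j\<close> for \<open>j \<in> J\<close> form a system of coordinates, that is, they give an
  automorphism of the space; it maps the common kernel of those with index in \<open>I\<close> onto a
  coordinate subspace.
\<close>

lemma dim_common_kernel:
  fixes b :: "nat \<Rightarrow> complex ^ ('n::finite)"
  assumes J: "finite J" "card J = CARD('n)" and I: "I \<subseteq> J"
    and triv: "\<And>v. (\<forall>j\<in>J. pairing (b j) v = 0) \<Longrightarrow> v = 0"
  shows "vec.dim {v. \<forall>i\<in>I. pairing (b i) v = 0} = CARD('n) - card I"
proof -
  obtain f where f: "bij_betw f (UNIV :: 'n set) J"
    using J finite_same_card_bij[of "UNIV :: 'n set" J] by auto
  define A :: "complex ^ 'n ^ 'n" where "A = (\<chi> k. b (f k))"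
  have A: "(A *v x) $ k = pairing (b (f k)) x" for x k
    by (simp add: A_def matrix_vector_mult_def pairing_def)
  have "x = 0" if "A *v x = 0" for x
  proof (rule triv)
    show "\<forall>j\<in>J. pairing (b j) x = 0"
      using f that by (auto simp: A[symmetric] bij_betw_def)
  qed
  then have inj: "inj ((*v) A)"
    by (simp add: vec.linear_inj_iff_eq_0)
  then have surj: "surj ((*v) A)"
    using vec.linear_inj_imp_surj[OF matrix_vector_mul_linear_gen] by blast
  let ?W = "{v. \<forall>i\<in>I. pairing (b i) v = 0}"
  have mem: "x \<in> ?W \<longleftrightarrow> (\<forall>k. k \<notin> {k. f k \<notin> I} \<longrightarrow> (A *v x) $ k = 0)" for x
    using f I by (auto simp: A bij_betw_def)
  have "(*v) A ` ?W = {y. \<forall>k. k \<notin> {k. f k \<notin> I} \<longrightarrow> y $ k = 0}"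
  proof (intro equalityI subsetI)
    fix y :: "complex ^ 'n" assume y: "y \<in> {y. \<forall>k. k \<notin> {k. f k \<notin> I} \<longrightarrow> y $ k = 0}"
    obtain x where "y = A *v x"
      using surj by blast
    with y show "y \<in> (*v) A ` ?W"
      using mem by blast
  qed (use mem in blast)
  then have "vec.dim ((*v) A ` ?W) = card {k. f k \<notin> I}"
    by (simp only: dim_substandard_cart)
  moreover have "vec.dim ((*v) A ` ?W) = vec.dim ?W"
    using inj by (intro vec.dim_image_eq matrix_vector_mul_linear_gen) (auto intro: inj_on_subset)
  moreover have "card {k. f k \<notin> I} = CARD('n) - card I"
  proof -
    have "bij_betw f {k. f k \<notin> I} (J - I)"
      using f by (auto simp: bij_betw_def inj_on_def)
    then have "card {k. f k \<notin> I} = card (J - I)"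
      by (rule bij_betw_same_card)
    also have "\<dots> = CARD('n) - card I"
      using J I by (simp add: card_Diff_subset finite_subset)
    finally show ?thesis .
  qed
  ultimately show ?thesis
    by simp
qed

section \<open>General position and general linearity as full rank\<close>

lemma general_position_iff_full_rank:
  "general_position r Q \<longleftrightarrow> full_rank r (\<lambda>j. coords (Q j))"
proof -
  have ex_iff: "(\<exists>H. hyperplane H \<and> Q ` I \<subseteq> H) \<longleftrightarrow>
      (\<exists>m. m \<noteq> 0 \<and> (\<forall>i\<in>I. pairing (coords (Q i)) m = 0))" for I
    unfolding hyperplane_iff by (auto simp: image_subset_iff pairing_commute)
  then show ?thesis
    unfolding general_position_def full_rank_def ex_iff by blast
qed

text \<open>
  The bound on \<open>r\<close> makes every family of fewer than \<open>CARD('n)\<close> forms part of one with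
  \<open>CARD('n)\<close> members; without it, full rank would hold vacuously and say nothing about the
  smaller families. More than \<open>CARD('n)\<close> forms contain \<open>CARD('n)\<close> of them that already have
  no common zero.
\<close>

lemma generally_linear_iff_full_rank:
  fixes b :: "nat \<Rightarrow> complex ^ ('n::finite)"
  assumes r: "CARD('n) \<le> r"
  shows "generally_linear r (\<lambda>i. lin_form (b i)) \<longleftrightarrow> full_rank r b"
proof
  assume gl: "generally_linear r (\<lambda>i. lin_form (b i))"
  show "full_rank r b"
    unfolding full_rank_def
  proof (intro allI impI, elim conjE)
    fix I v assume I: "I \<subseteq> {1..r}" "card I = CARD('n)" and v: "\<forall>i\<in>I. pairing (b i) v = 0"
    have "zero_locus ((\<lambda>i. lin_form (b i)) ` I) = {}"
      using gl I by (simp add: generally_linear_def)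
    with v show "v = 0"
      by (auto simp: zero_locus_lin_forms)
  qed
next
  assume fr: "full_rank r b"
  let ?W = "\<lambda>I. {v. \<forall>i\<in>I. pairing (b i) v = 0}"
  have small: "linear_subvariety_of_dim (CARD('n) - 1 - card I) (zero_locus ((\<lambda>i. lin_form (b i)) ` I))"
    if I: "I \<subseteq> {1..r}" "card I \<le> CARD('n) - 1" for I
  proof -
    obtain J where J: "I \<subseteq> J" "J \<subseteq> {1..r}" "card J = CARD('n)"
      using exists_subset_between[of I "CARD('n)" "{1..r}"] I r
        diff_le_self[of "CARD('n)" 1] by (metis card_atLeastAtMost diff_Suc_1 finite_atLeastAtMost le_trans)
    have "vec.dim (?W I) = CARD('n) - card I"
    proof (rule dim_common_kernel[OF _ J(3,1)])
      show "finite J"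
        using J(2) finite_subset by blast
      show "v = 0" if "\<forall>j\<in>J. pairing (b j) v = 0" for v
        using fr J that by (auto simp: full_rank_def)
    qed
    moreover have "CARD('n) - card I = CARD('n) - 1 - card I + 1"
      using I zero_less_card_finite[where 'a = 'n] by linarith
    ultimately show ?thesis
      unfolding linear_subvariety_of_dim_def
      by (intro exI[of _ "?W I"] conjI subspace_common_kernel zero_locus_lin_forms) simp
  qed
  have large: "zero_locus ((\<lambda>i. lin_form (b i)) ` I) = {}"
    if I: "I \<subseteq> {1..r}" "card I > CARD('n) - 1" for I
  proof -
    obtain J where J: "J \<subseteq> I" "card J = CARD('n)"
      using obtain_subset_with_card_n[of "CARD('n)" I] I by (metis Suc_leI Suc_pred' zero_less_card_finite)
    then have "v = 0" if "\<forall>i\<in>I. pairing (b i) v = 0" for v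
      using fr I that unfolding full_rank_def by (meson order_trans subsetD)
    then show ?thesis
      by (auto simp: zero_locus_lin_forms)
  qed
  show "generally_linear r (\<lambda>i. lin_form (b i))"
    unfolding generally_linear_def using small large linear_form_lin_form by blast
qed

text \<open>
  A hyperplane determines its form only up to a scalar; this allows any choice of the forms.
\<close>

lemma generally_linear_cong:
  assumes "\<And>i. i \<in> {1..r} \<Longrightarrow> linear_form (L i) \<and> linear_form (L' i)"
    and "\<And>i. i \<in> {1..r} \<Longrightarrow> zero_locus {L i} = zero_locus {L' i}"
  shows "generally_linear r L \<longleftrightarrow> generally_linear r L'"
proof -
  have "zero_locus (L ` I) = zero_locus (L' ` I)" if "I \<subseteq> {1..r}" for I
    unfolding zero_locus_image using assms(2) that by blast
  then show ?thesis
    using assms(1) unfolding generally_linear_def by auto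
qed

section \<open>Hadamard products with hyperplanes\<close>

lemma nonzero_coords_if_off_coordinate_hyperplanes:
  fixes P :: "('m::finite) proj"
  assumes "CARD('m) \<ge> 2" "P \<notin> coord_locus (CARD('m) - 2)"
  shows "coords P $ i \<noteq> 0"
proof
  assume "coords P $ i = 0"
  then have "P \<in> (\<Inter>j\<in>{i}. zero_locus {variable j})"
    by (simp add: zero_locus_def eval_variable)
  moreover have "card {i} = CARD('m) - 1 - (CARD('m) - 2)"
    using assms(1) by simp
  ultimately have "P \<in> coord_locus (CARD('m) - 2)"
    unfolding coord_locus_def by blast
  then show False
    using assms(2) by simp
qed

lemma coordinate_point_in_coord_locus_0:
  "of_coords (axis k 1) \<in> (coord_locus 0 :: ('m::finite) proj set)"
proof -
  have "(axis k 1 :: complex ^ 'm) \<noteq> 0"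
    by (simp add: axis_eq_0_iff)
  then obtain l where "coords (of_coords (axis k 1 :: complex ^ 'm)) = l *s axis k 1"
    by (rule coords_of_coords)
  then have "of_coords (axis k 1 :: complex ^ 'm) \<in> (\<Inter>j\<in>- {k}. zero_locus {variable j})"
    by (auto simp: zero_locus_def eval_variable axis_def)
  moreover have "card (- {k}) = CARD('m) - 1 - 0"
    by (simp add: Compl_eq_Diff_UNIV)
  ultimately show ?thesis
    unfolding coord_locus_def by blast
qed

lemma nonzero_coeffs_if_no_coordinate_points:
  fixes a :: "complex ^ ('m::finite)"
  assumes "zero_locus {lin_form a} \<inter> coord_locus 0 = {}"
  shows "a $ k \<noteq> 0"
proof -
  have "of_coords (axis k 1) \<notin> zero_locus {lin_form a}"
    using assms coordinate_point_in_coord_locus_0[of k] by blast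
  moreover have "(axis k 1 :: complex ^ 'm) \<noteq> 0"
    by (simp add: axis_eq_0_iff)
  ultimately show ?thesis
    by (simp add: of_coords_in_hyperplane_iff del: in_hyperplane_iff)
qed

text \<open>
  Componentwise multiplication by the coordinates of \<open>P\<close> is invertible, so the products already
  fill a hyperplane and the Zariski closure adds nothing.
\<close>

lemma hadamard_hyperplane:
  assumes p: "\<And>i. coords P $ i \<noteq> 0"
  shows "P \<star> zero_locus {lin_form a} = zero_locus {lin_form (a * (\<chi> i. 1 / coords P $ i))}"
    (is "_ = ?R")
proof -
  let ?p = "coords P"
  have pair: "pairing (a * (\<chi> i. 1 / ?p $ i)) (?p * q) = pairing a q" for q
    using p by (simp add: pairing_def)
  have "{hadamard P Q | Q. Q \<in> zero_locus {lin_form a} \<and> hadamard_defined P Q} = ?R"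
  proof (intro equalityI subsetI)
    fix R assume "R \<in> {hadamard P Q | Q. Q \<in> zero_locus {lin_form a} \<and> hadamard_defined P Q}"
    then obtain Q where Q: "R = of_coords (?p * coords Q)" "pairing a (coords Q) = 0"
        and "hadamard_defined P Q"
      by (auto simp: hadamard_def)
    then have "?p * coords Q \<noteq> 0"
      by (auto simp: hadamard_defined_def vec_eq_iff)
    then show "R \<in> ?R"
      unfolding Q(1) by (simp add: of_coords_in_hyperplane_iff pair Q(2) del: in_hyperplane_iff)
  next
    fix R assume R: "R \<in> ?R"
    define q where "q = (\<chi> i. coords R $ i / ?p $ i)"
    have pq: "?p * q = coords R"
      using p by (simp add: q_def vec_eq_iff)
    then have nz: "?p * q \<noteq> 0"
      by (simp add: coords_nonzero)
    then have q: "q \<noteq> 0"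
      by auto
    have "of_coords q \<in> zero_locus {lin_form a}"
      using R pair[of q] q by (simp add: of_coords_in_hyperplane_iff[OF q] pq del: in_hyperplane_iff)
        (simp add: pq)
    moreover have "hadamard_defined P (of_coords q)"
      using hadamard_defined_of_coords[OF coords_nonzero q, of P] nz by simp
    moreover have "hadamard P (of_coords q) = R"
      using hadamard_of_coords[OF nz] pq by simp
    ultimately show "R \<in> {hadamard P Q | Q. Q \<in> zero_locus {lin_form a} \<and> hadamard_defined P Q}"
      by blast
  qed
  moreover have "zariski_closed ?R"
    unfolding zariski_closed_def using linear_form_lin_form by blast
  ultimately show ?thesis
    unfolding hadamard_variety_def by (metis hull_same)
qed

lemma coords_cremona:
  assumes "\<And>i. coords P $ i \<noteq> 0"
  obtains k where "k \<noteq> 0" "coords (cremona P) = k *s (\<chi> i. 1 / coords P $ i)"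
proof -
  have "(\<chi> i. 1 / coords P $ i) \<noteq> 0"
    using assms by (auto simp: vec_eq_iff)
  then show ?thesis
    using that coords_of_coords unfolding cremona_def by metis
qed

lemma general_position_cremona_iff:
  assumes "\<And>j i. j \<in> {1..r} \<Longrightarrow> coords (P j) $ i \<noteq> 0"
  shows "general_position r (\<lambda>j. cremona (P j)) \<longleftrightarrow> full_rank r (\<lambda>j. \<chi> i. 1 / coords (P j) $ i)"
proof -
  have "\<exists>k. k \<noteq> 0 \<and> coords (cremona (P j)) = k *s (\<chi> i. 1 / coords (P j) $ i)" if "j \<in> {1..r}" for j
    using coords_cremona[of "P j"] assms[OF that] by metis
  then obtain k where
    "\<And>j. j \<in> {1..r} \<Longrightarrow> k j \<noteq> 0 \<and> coords (cremona (P j)) = k j *s (\<chi> i. 1 / coords (P j) $ i)"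
    by metis
  then have "full_rank r (\<lambda>j. coords (cremona (P j))) \<longleftrightarrow> full_rank r (\<lambda>j. \<chi> i. 1 / coords (P j) $ i)"
    by (rule full_rank_scale)
  then show ?thesis
    by (simp add: general_position_iff_full_rank)
qed

section \<open>Weak Hadamard star configurations\<close>

theorem theorem4p3:
  fixes n c r :: nat
    and H :: "('m::finite) proj set"
    and P :: "nat \<Rightarrow> 'm proj"
    and Hs :: "nat \<Rightarrow> 'm proj set"
  assumes "CARD('m) = n + 1"
    and "n \<ge> 1"
    and "c \<in> {1..n}"
    and "r \<ge> n + 1"
    and "hyperplane H"
    and "H \<inter> coord_locus 0 = {}"
    and "\<forall>j\<in>{1..r}. P j \<notin> coord_locus (n - 1)"
    and "\<forall>j\<in>{1..r}. Hs j = P j \<star> H"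
  shows "weak_hadamard_star_configuration c r Hs (star_union c r Hs) \<longleftrightarrow>
         general_position r (\<lambda>j. cremona (P j))"
proof -
  obtain a where H: "H = zero_locus {lin_form a}"
    using assms(5) by (auto simp: hyperplane_iff)
  have a: "a $ i \<noteq> 0" for i
    using nonzero_coeffs_if_no_coordinate_points assms(6) H by blast
  have p: "coords (P j) $ i \<noteq> 0" if "j \<in> {1..r}" for j i
  proof (rule nonzero_coords_if_off_coordinate_hyperplanes)
    show "P j \<notin> coord_locus (CARD('m) - 2)"
      using assms(1,7) that by (simp add: numeral_2_eq_2)
  qed (use assms(1,2) in simp)
  define s where "s j = (\<chi> i. 1 / coords (P j) $ i)" for j
  define L where "L j = lin_form (a * s j)" for j
  have Hs: "Hs j = zero_locus {L j}" if "j \<in> {1..r}" for j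
    using assms(8) that hadamard_hyperplane[OF p, of j a] by (simp add: H L_def s_def)
  have hset: "hadamard_set r L"
    unfolding hadamard_set_def
  proof (intro conjI exI ballI)
    show "zero_locus {L j} = P j \<star> zero_locus {lin_form a}" if "j \<in> {1..r}" for j
      using assms(8) that Hs H by simp
  qed (simp_all only: L_def linear_form_lin_form)
  have star: "star_union c r Hs = (\<Union>I\<in>{I. I \<subseteq> {1..r} \<and> card I = c}. zero_locus (L ` I))"
    unfolding star_union_def zero_locus_image by (intro SUP_cong INF_cong refl) (use Hs in blast)
  have "weak_hadamard_star_configuration c r Hs (star_union c r Hs) \<longleftrightarrow> generally_linear r L"
  proof
    assume "weak_hadamard_star_configuration c r Hs (star_union c r Hs)"
    then obtain L' where L': "\<forall>i\<in>{1..r}. Hs i = zero_locus {L' i}" "generally_linear r L'"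
      by (auto simp: weak_hadamard_star_configuration_def star_configuration_def)
    have "generally_linear r L' \<longleftrightarrow> generally_linear r L"
    proof (rule generally_linear_cong)
      show "linear_form (L' i) \<and> linear_form (L i)" if "i \<in> {1..r}" for i
        using L'(2) that by (simp add: generally_linear_def L_def linear_form_lin_form del: One_nat_def)
      show "zero_locus {L' i} = zero_locus {L i}" if "i \<in> {1..r}" for i
        using L'(1) Hs that by simp
    qed
    then show "generally_linear r L"
      using L'(2) by simp
  next
    assume "generally_linear r L"
    then have "star_configuration c r L (star_union c r Hs)"
      using assms(1,3) star by (simp add: star_configuration_def)
    then show "weak_hadamard_star_configuration c r Hs (star_union c r Hs)"
      using Hs hset unfolding weak_hadamard_star_configuration_def by blast
  qed
  also have "\<dots> \<longleftrightarrow> full_rank r (\<lambda>j. a * s j)"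
    unfolding L_def using assms(1,4) by (intro generally_linear_iff_full_rank) simp
  also have "\<dots> \<longleftrightarrow> full_rank r s"
    using a by (rule full_rank_mult)
  also have "\<dots> \<longleftrightarrow> general_position r (\<lambda>j. cremona (P j))"
    using general_position_cremona_iff[of r P, OF p] by (simp add: s_def[abs_def])
  finally show ?thesis .
qed

end
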